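(* Let $(p_{ij} \colon X_j \to X_i)_{i \sqsubseteq j \in I}$ be a projective system of topological spaces, with canonical projective limit $X, (p_i)_{i \in I}$. If every $X_i$ is sober, then $(\mathcal Q_{\mathsf V}\, p_{ij} \colon \mathcal Q_{\mathsf V} X_j \to \mathcal Q_{\mathsf V} X_i)_{i \sqsubseteq j \in I}$ is a projective system of topological spaces, and $\mathcal Q_{\mathsf V} X, (\mathcal Q_{\mathsf V}\, p_i)_{i \in I}$ is its projective limit, up to homeomorphism. The same holds with $\mathcal Q_{0\mathsf V}$ in lieu of $\mathcal Q_{\mathsf V}$.
   Context: A space is sober iff it is $T_0$ and every irreducible closed subset is the closure of a point. The specialization preordering is: $x \leq y$ iff every open neighborhood of $x$ contains $y$; $\uparrow A$ denotes upward closure. A subset is saturated iff it is upwards-closed. Compactness is the open cover property, with no separation axiom. A projective system $(p_{ij} \colon X_j \to X_i)_{i \sqsubseteq j \in I}$ consists of a directed preordered set $(I,\sqsubseteq)$, spaces $X_i$, and continuous maps $p_{ij}$ ($i \sqsubseteq j$) with $p_{ii} = \mathrm{id}$ and $p_{ij} \circ p_{jk} = p_{ik}$ for $i \sqsubseteq j \sqsubseteq k$. Its canonical projective limit is $X = \{\vec x \in \prod_{i} X_i \mid p_{ij}(x_j) = x_i \text{ for all } i \sqsubseteq j\}$ with the subspace topology of the product, $p_i$ being projection onto coordinate $i$. Saying that $Y, (q_i)_{i\in I}$ is the projective limit up to homeomorphism of a projective system with canonical limit $Z$ means that the map $y \mapsto (q_i(y))_{i \in I}$ is a (well-defined) homeomorphism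 from $Y$ onto $Z$. $\mathcal Q_{0\mathsf V} X$ (resp. $\mathcal Q_{\mathsf V} X$) is the set of all compact saturated subsets of $X$ (resp., all non-empty ones) with the upper Vietoris topology, which has as basic open sets $\Box U = \{Q \mid Q \subseteq U\}$, for $U$ open in $X$. Both are endofunctors on the category of topological spaces, a continuous map $f \colon X \to Y$ acting by $Q \mapsto \uparrow f[Q]$, where $f[Q]$ is the image of $Q$. *)

theory Defs
  imports "HOL-Analysis.Analysis"
begin

definition specialization :: "'a topology \<Rightarrow> 'a \<Rightarrow> 'a \<Rightarrow> bool" where
  "specialization T x y \<longleftrightarrow> x \<in> topspace T \<and> y \<in> topspace T \<and>
     (\<forall>U. openin T U \<and> x \<in> U \<longrightarrow> y \<in> U)"

definition up_closure :: "'a topology \<Rightarrow> 'a set \<Rightarrow> 'a set" where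
  "up_closure T A = {y. \<exists>x\<in>A. specialization T x y}"

definition saturated_in :: "'a topology \<Rightarrow> 'a set \<Rightarrow> bool" where
  "saturated_in T A \<longleftrightarrow> A \<subseteq> topspace T \<and>
     (\<forall>x\<in>A. \<forall>y. specialization T x y \<longrightarrow> y \<in> A)"

text \<open>Irreducible closed sets are non-empty by convention (otherwise no space would be sober).\<close>

definition irreducible_closedin :: "'a topology \<Rightarrow> 'a set \<Rightarrow> bool" where
  "irreducible_closedin T C \<longleftrightarrow> closedin T C \<and> C \<noteq> {} \<and>
     (\<forall>D E. closedin T D \<and> closedin T E \<and> C \<subseteq> D \<union> E \<longrightarrow> C \<subseteq> D \<or> C \<subseteq> E)"

definition sober_space :: "'a topology \<Rightarrow> bool" where
  "sober_space T \<longleftrightarrow> t0_space T \<and>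
     (\<forall>C. irreducible_closedin T C \<longrightarrow> (\<exists>x\<in>topspace T. C = T closure_of {x}))"


text \<open>The spaces \<open>X i\<close> (\<open>i \<in> I\<close>) are topologies with arbitrary carriers inside a common type
  \<open>'a\<close>; the transition maps only matter on those carriers. A directed set is non-empty.\<close>

definition directed_preorder_on :: "'i set \<Rightarrow> 'i rel \<Rightarrow> bool" where
  "directed_preorder_on I r \<longleftrightarrow> preorder_on I r \<and> I \<noteq> {} \<and>
     (\<forall>i\<in>I. \<forall>j\<in>I. \<exists>k\<in>I. (i, k) \<in> r \<and> (j, k) \<in> r)"

definition projective_system ::
  "'i set \<Rightarrow> 'i rel \<Rightarrow> ('i \<Rightarrow> 'a topology) \<Rightarrow> ('i \<Rightarrow> 'i \<Rightarrow> 'a \<Rightarrow> 'a) \<Rightarrow> bool" where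
  "projective_system I r X p \<longleftrightarrow>
     directed_preorder_on I r \<and>
     (\<forall>i j. (i, j) \<in> r \<longrightarrow> continuous_map (X j) (X i) (p i j)) \<and>
     (\<forall>i\<in>I. \<forall>x\<in>topspace (X i). p i i x = x) \<and>
     (\<forall>i j k. (i, j) \<in> r \<and> (j, k) \<in> r \<longrightarrow>
        (\<forall>x\<in>topspace (X k). p i j (p j k x) = p i k x))"

definition projective_limit ::
  "'i set \<Rightarrow> 'i rel \<Rightarrow> ('i \<Rightarrow> 'a topology) \<Rightarrow> ('i \<Rightarrow> 'i \<Rightarrow> 'a \<Rightarrow> 'a) \<Rightarrow> ('i \<Rightarrow> 'a) topology" where
  "projective_limit I r X p =
     subtopology (product_topology X I) {x. \<forall>i j. (i, j) \<in> r \<longrightarrow> p i j (x j) = x i}"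

definition is_projective_limit ::
  "'i set \<Rightarrow> 'i rel \<Rightarrow> ('i \<Rightarrow> 'a topology) \<Rightarrow> ('i \<Rightarrow> 'i \<Rightarrow> 'a \<Rightarrow> 'a) \<Rightarrow>
   'b topology \<Rightarrow> ('i \<Rightarrow> 'b \<Rightarrow> 'a) \<Rightarrow> bool" where
  "is_projective_limit I r X p Y q \<longleftrightarrow>
     homeomorphic_map Y (projective_limit I r X p) (\<lambda>y. \<lambda>i\<in>I. q i y)"


definition compact_saturated_sets :: "'a topology \<Rightarrow> 'a set set" where
  "compact_saturated_sets T = {Q. compactin T Q \<and> saturated_in T Q}"

definition upper_vietoris_on :: "'a topology \<Rightarrow> 'a set set \<Rightarrow> 'a set topology" where
  "upper_vietoris_on T \<Q> = topology_generated_by {{Q \<in> \<Q>. Q \<subseteq> U} |U. openin T U}"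

definition Q0V :: "'a topology \<Rightarrow> 'a set topology" where
  "Q0V T = upper_vietoris_on T (compact_saturated_sets T)"

definition QV :: "'a topology \<Rightarrow> 'a set topology" where
  "QV T = upper_vietoris_on T (compact_saturated_sets T - {{}})"

text \<open>The action on a continuous map into \<open>T\<close> (the same formula for \<open>QV\<close> and \<open>Q0V\<close>).\<close>

definition Q_map :: "'b topology \<Rightarrow> ('a \<Rightarrow> 'b) \<Rightarrow> 'a set \<Rightarrow> 'b set" where
  "Q_map T f Q = up_closure T (f ` Q)"


text \<open>The generating sets form a base, and the carriers are the intended ones.\<close>

lemma openin_upper_vietoris_on:
  "openin (upper_vietoris_on T \<Q>) =
     arbitrary union_of (\<lambda>S. \<exists>U. openin T U \<and> S = {Q \<in> \<Q>. Q \<subseteq> U})"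
    (is "_ = arbitrary union_of ?B")
proof -
  have ist: "istopology (arbitrary union_of ?B)"
  proof (rule istopology_base)
    fix S S' assume "?B S" "?B S'"
    then obtain U U' where "openin T U" "openin T U'"
      "S = {Q \<in> \<Q>. Q \<subseteq> U}" "S' = {Q \<in> \<Q>. Q \<subseteq> U'}" by blast
    then show "?B (S \<inter> S')"
      by (intro exI[of _ "U \<inter> U'"]) auto
  qed
  show ?thesis
  proof (rule ext, rule iffI)
    fix W assume "openin (upper_vietoris_on T \<Q>) W"
    then have "generate_topology_on {{Q \<in> \<Q>. Q \<subseteq> U} |U. openin T U} W"
      unfolding upper_vietoris_on_def by (rule openin_topology_generated_by)
    then show "(arbitrary union_of ?B) W"
      by (rule generate_topology_on_coarsest[OF ist, rotated])
         (auto intro!: arbitrary_union_of_inc)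
  next
    fix W assume "(arbitrary union_of ?B) W"
    then obtain \<U> where "\<And>S. S \<in> \<U> \<Longrightarrow> ?B S" "W = \<Union>\<U>"
      by (auto simp: union_of_def)
    moreover have "openin (upper_vietoris_on T \<Q>) S" if "?B S" for S
      unfolding upper_vietoris_on_def using that by (intro topology_generated_by_Basis) blast
    ultimately show "openin (upper_vietoris_on T \<Q>) W"
      by blast
  qed
qed

lemma topspace_upper_vietoris_on:
  assumes "\<And>Q. Q \<in> \<Q> \<Longrightarrow> Q \<subseteq> topspace T"
  shows "topspace (upper_vietoris_on T \<Q>) = \<Q>"
  using assms unfolding upper_vietoris_on_def topology_generated_by_topspace by blast

lemma topspace_Q0V: "topspace (Q0V T) = {Q. compactin T Q \<and> saturated_in T Q}"
  unfolding Q0V_def compact_saturated_sets_def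
  by (intro topspace_upper_vietoris_on) (auto simp: saturated_in_def)

lemma topspace_QV: "topspace (QV T) = {Q. compactin T Q \<and> saturated_in T Q \<and> Q \<noteq> {}}"
  unfolding QV_def compact_saturated_sets_def
  by (subst topspace_upper_vietoris_on) (auto simp: saturated_in_def)

end

theory Submission
  imports Defs
begin

text \<open>
  The systems of hyperspaces are projective by functoriality; what has to be proved is that the
  comparison map into their limit is bijective and open. It is bijective because, given compact
  saturated sets \<open>Q i\<close> in the sober spaces \<open>X i\<close>, compatible under the maps \<open>Q \<mapsto> \<up>p i j[Q]\<close>, there is exactly one compact saturated set
  in the limit with images \<open>Q i\<close>, namely \<open>limit_set\<close>, the set of threads \<open>x\<close> with \<open>x i \<in> Q i\<close>
  for every \<open>i\<close>.

  Sobriety enters through a non-emptiness theorem, \<open>meeting_family_limit_point\<close>: closed sets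
  \<open>C i\<close> that are compatible with the transition maps and meet every \<open>Q i\<close> share a thread lying in
  \<open>limit_set\<close>. By Zorn's lemma and the compactness of the \<open>Q i\<close>, the family \<open>C\<close> may be taken
  minimal. Minimality combined with directedness makes every \<open>C i\<close> irreducible, so sobriety provides
  generic points; these are unique, hence form a thread, and they belong to \<open>Q i\<close> because a
  generic point lies above every point of \<open>C i\<close> and \<open>Q i\<close> is saturated.

  Two choices of closed sets give existence. Complements of open sets show that an increasing
  family of open sets covering \<open>limit_set\<close> already covers some \<open>Q i\<close>, so \<open>limit_set\<close> inherits
  compactness from \<open>Q i\<close> (\<open>limit_set_compact_saturated\<close>). Preimages of the closure of a point
  \<open>y \<in> Q i\<close> produce a thread whose \<open>i\<close>-th coordinate is below \<open>y\<close>, so that the \<open>i\<close>-th image of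
  \<open>limit_set\<close> is all of \<open>Q i\<close> (\<open>Q_map_limit_set\<close>).

  Uniqueness and openness of the comparison map rest on one shrinking argument. Since the index set
  is directed, an open neighbourhood \<open>U\<close> of a compact set in the limit contains the preimage of an
  open set \<open>V\<close> of a single \<open>X i\<close> that still covers the compact set (\<open>lim_compact_base\<close>). Hence a
  compact saturated set is determined by its images, and the basic open set \<open>{Q. Q \<subseteq> U}\<close> is mapped
  onto a union of sets of compatible families \<open>R\<close> with \<open>R i \<subseteq> V\<close> for one index \<open>i\<close>.
\<close>

section \<open>Specialization, saturation and upward closure\<close>

lemma specialization_refl: "x \<in> topspace T \<Longrightarrow> specialization T x x"
  by (simp add: specialization_def)

lemma specialization_trans:
  "specialization T x y \<Longrightarrow> specialization T y z \<Longrightarrow> specialization T x z"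
  by (simp add: specialization_def)

lemma specialization_iff_closure_of:
  assumes "x \<in> topspace T" "y \<in> topspace T"
  shows "specialization T x y \<longleftrightarrow> x \<in> T closure_of {y}"
  using assms by (auto simp: specialization_def in_closure_of)

lemma specialization_continuous_map:
  assumes "continuous_map S T f" "specialization S x y"
  shows "specialization T (f x) (f y)"
proof -
  have xy: "x \<in> topspace S" "y \<in> topspace S"
    using assms(2) by (auto simp: specialization_def)
  have "f y \<in> U" if "openin T U" "f x \<in> U" for U
    using openin_continuous_map_preimage[OF assms(1) that(1)] assms(2) that(2) xy
    unfolding specialization_def by blast
  then show ?thesis
    using xy continuous_map_image_subset_topspace[OF assms(1)] by (auto simp: specialization_def)
qed

lemma up_closure_subset_topspace: "up_closure T A \<subseteq> topspace T"
  by (auto simp: up_closure_def specialization_def)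

lemma subset_up_closure: "A \<subseteq> topspace T \<Longrightarrow> A \<subseteq> up_closure T A"
  by (auto simp: up_closure_def intro: specialization_refl)

lemma saturated_in_up_closure: "saturated_in T (up_closure T A)"
  unfolding saturated_in_def
  by (auto simp: up_closure_def intro: specialization_trans) (simp add: specialization_def)

lemma up_closure_saturated: "saturated_in T Q \<Longrightarrow> up_closure T Q = Q"
  using subset_up_closure[of Q T] by (auto simp: saturated_in_def up_closure_def)

lemma up_closure_subset_open_iff:
  assumes "openin T U" "A \<subseteq> topspace T"
  shows "up_closure T A \<subseteq> U \<longleftrightarrow> A \<subseteq> U"
  using assms subset_up_closure[OF assms(2)] by (auto simp: up_closure_def specialization_def)

text \<open>Open sets are upwards closed, so a set and its upward closure have the same open covers.\<close>

lemma compactin_up_closure: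
  assumes "compactin T A"
  shows "compactin T (up_closure T A)"
  unfolding compactin_def
proof (intro conjI allI impI)
  show "up_closure T A \<subseteq> topspace T"
    by (rule up_closure_subset_topspace)
  have A: "A \<subseteq> topspace T"
    using assms by (rule compactin_subset_topspace)
  fix \<U> assume \<U>: "(\<forall>U\<in>\<U>. openin T U) \<and> up_closure T A \<subseteq> \<Union>\<U>"
  then have "A \<subseteq> \<Union>\<U>"
    using subset_up_closure[OF A] by blast
  then obtain \<F> where \<F>: "finite \<F>" "\<F> \<subseteq> \<U>" "A \<subseteq> \<Union>\<F>"
    using assms \<U> unfolding compactin_def by meson
  have "openin T (\<Union>\<F>)"
    using \<F>(2) \<U> by blast
  then have "up_closure T A \<subseteq> \<Union>\<F>"
    using \<F>(3) up_closure_subset_open_iff[OF _ A] by simp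
  then show "\<exists>\<F>. finite \<F> \<and> \<F> \<subseteq> \<U> \<and> up_closure T A \<subseteq> \<Union>\<F>"
    using \<F>(1,2) by (intro exI conjI)
qed

lemma Q_map_compact_saturated:
  assumes "continuous_map S T f" "Q \<in> compact_saturated_sets S"
  shows "Q_map T f Q \<in> compact_saturated_sets T"
  using assms image_compactin[of S Q T f] unfolding compact_saturated_sets_def Q_map_def
  by (simp add: compactin_up_closure saturated_in_up_closure)

lemma Q_map_subset_open_iff:
  assumes "continuous_map S T f" "Q \<subseteq> topspace S" "openin T U"
  shows "Q_map T f Q \<subseteq> U \<longleftrightarrow> Q \<subseteq> {x \<in> topspace S. f x \<in> U}"
proof -
  have "f ` Q \<subseteq> topspace T"
    using assms(1,2) continuous_map_image_subset_topspace by blast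
  then show ?thesis
    using up_closure_subset_open_iff[OF assms(3)] assms(2) unfolding Q_map_def by blast
qed

lemma Q_map_empty_iff:
  assumes "continuous_map S T f" "Q \<subseteq> topspace S"
  shows "Q_map T f Q = {} \<longleftrightarrow> Q = {}"
  using Q_map_subset_open_iff[OF assms openin_empty] by auto

lemma Q_map_ident:
  assumes "saturated_in T Q" "\<And>x. x \<in> topspace T \<Longrightarrow> f x = x"
  shows "Q_map T f Q = Q"
proof -
  have "f ` Q = Q"
    using assms by (force simp: saturated_in_def)
  then show ?thesis
    using up_closure_saturated[OF assms(1)] by (simp add: Q_map_def)
qed

text \<open>Continuous maps are monotone, so taking the upward closure halfway does not enlarge the final
  one. Stating \<open>g \<circ> f\<close> as a function \<open>h\<close> that agrees with it only on \<open>Q\<close> suits transition maps, which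
  compose as expected only on their carriers.\<close>

lemma Q_map_comp:
  assumes g: "continuous_map S T g" and f: "f ` Q \<subseteq> topspace S"
    and h: "\<And>x. x \<in> Q \<Longrightarrow> g (f x) = h x"
  shows "Q_map T g (Q_map S f Q) = Q_map T h Q"
proof (intro equalityI subsetI)
  fix y assume "y \<in> Q_map T g (Q_map S f Q)"
  then obtain x z where "x \<in> Q" "specialization S (f x) z" "specialization T (g z) y"
    by (auto simp: Q_map_def up_closure_def)
  then show "y \<in> Q_map T h Q"
    using specialization_trans[OF specialization_continuous_map[OF g]] h
    by (fastforce simp: Q_map_def up_closure_def)
next
  fix y assume "y \<in> Q_map T h Q"
  then obtain x where x: "x \<in> Q" "specialization T (g (f x)) y"
    using h by (auto simp: Q_map_def up_closure_def)
  moreover have "f x \<in> Q_map S f Q"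
    using x(1) f subset_up_closure[of "f ` Q" S] by (auto simp: Q_map_def)
  ultimately show "y \<in> Q_map T g (Q_map S f Q)"
    by (auto simp: Q_map_def up_closure_def)
qed

section \<open>The two hyperspaces at once\<close>

text \<open>The flag \<open>e\<close> says whether the empty set is a point, so that both hyperspaces are
  treated by the same argument.\<close>

abbreviation hyperspace_points :: "bool \<Rightarrow> 'a topology \<Rightarrow> 'a set set" where
  "hyperspace_points e T \<equiv> {Q \<in> compact_saturated_sets T. Q = {} \<longrightarrow> e}"

definition hyperspace :: "bool \<Rightarrow> 'a topology \<Rightarrow> 'a set topology" where
  "hyperspace e T = upper_vietoris_on T (hyperspace_points e T)"

lemma Q0V_eq_hyperspace: "Q0V T = hyperspace True T"
  by (simp add: Q0V_def hyperspace_def)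

lemma QV_eq_hyperspace: "QV T = hyperspace False T"
  unfolding QV_def hyperspace_def by (rule arg_cong[of _ _ "upper_vietoris_on T"]) auto

lemma compact_saturated_sets_subset: "Q \<in> compact_saturated_sets T \<Longrightarrow> Q \<subseteq> topspace T"
  by (simp add: compact_saturated_sets_def saturated_in_def)

lemma topspace_hyperspace: "topspace (hyperspace e T) = hyperspace_points e T"
  unfolding hyperspace_def
  by (rule topspace_upper_vietoris_on) (auto dest: compact_saturated_sets_subset)

lemma openin_hyperspace_box:
  assumes "openin T U"
  shows "openin (hyperspace e T) {Q \<in> hyperspace_points e T. Q \<subseteq> U}"
  unfolding hyperspace_def upper_vietoris_on_def
  using assms by (intro topology_generated_by_Basis) blast

lemma hyperspace_box_base:
  assumes "openin (hyperspace e T) W" "Q \<in> W"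
  obtains U where "openin T U" "Q \<subseteq> U" "{Q \<in> hyperspace_points e T. Q \<subseteq> U} \<subseteq> W"
proof -
  obtain \<B> where "W = \<Union>\<B>"
    "\<And>S. S \<in> \<B> \<Longrightarrow> \<exists>U. openin T U \<and> S = {Q \<in> hyperspace_points e T. Q \<subseteq> U}"
    using assms(1) unfolding hyperspace_def openin_upper_vietoris_on
    by (auto simp: union_of_def)
  note \<B> = this
  then obtain S where S: "S \<in> \<B>" "Q \<in> S"
    using assms(2) by auto
  obtain U where "openin T U" "S = {Q \<in> hyperspace_points e T. Q \<subseteq> U}"
    using \<B>(2)[OF S(1)] by auto
  then show thesis
    using that[of U] S \<B>(1) by auto
qed

lemma Q_map_in_hyperspace:
  assumes "continuous_map S T f" "Q \<in> hyperspace_points e S"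
  shows "Q_map T f Q \<in> hyperspace_points e T"
proof -
  have "Q_map T f Q = {} \<longleftrightarrow> Q = {}"
    using assms(2) by (intro Q_map_empty_iff[OF assms(1)]) (auto dest: compact_saturated_sets_subset)
  then show ?thesis
    using assms(2) Q_map_compact_saturated[OF assms(1)] by simp
qed

text \<open>The preimage of the basic open set \<open>{Q. Q \<subseteq> U}\<close> is the one given by \<open>f\<inverse>(U)\<close>.\<close>

lemma continuous_map_Q_map:
  assumes "continuous_map S T f"
  shows "continuous_map (hyperspace e S) (hyperspace e T) (Q_map T f)"
  unfolding continuous_map_def topspace_hyperspace
proof (intro conjI allI impI)
  show "Q_map T f \<in> (hyperspace_points e S) \<rightarrow> (hyperspace_points e T)"
    using Q_map_in_hyperspace[OF assms(1)] by blast
  fix W assume W: "openin (hyperspace e T) W"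
  show "openin (hyperspace e S) {Q \<in> hyperspace_points e S. Q_map T f Q \<in> W}"
    unfolding openin_subopen[of _ "{Q \<in> hyperspace_points e S. Q_map T f Q \<in> W}"]
  proof
    fix Q assume "Q \<in> {Q \<in> hyperspace_points e S. Q_map T f Q \<in> W}"
    then have Q: "Q \<in> hyperspace_points e S" "Q_map T f Q \<in> W" by auto
    obtain U where U: "openin T U" "Q_map T f Q \<subseteq> U"
      "{Q \<in> hyperspace_points e T. Q \<subseteq> U} \<subseteq> W"
      using hyperspace_box_base[OF W Q(2)] .
    let ?V = "{x \<in> topspace S. f x \<in> U}"
    have V: "Q' \<subseteq> ?V \<longleftrightarrow> Q_map T f Q' \<subseteq> U" if "Q' \<in> compact_saturated_sets S" for Q'
      using Q_map_subset_open_iff[OF assms(1) compact_saturated_sets_subset[OF that] U(1)] by simp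
    show "\<exists>N. openin (hyperspace e S) N \<and> Q \<in> N \<and>
        N \<subseteq> {Q \<in> hyperspace_points e S. Q_map T f Q \<in> W}"
    proof (intro exI conjI)
      show "openin (hyperspace e S) {Q \<in> hyperspace_points e S. Q \<subseteq> ?V}"
        by (intro openin_hyperspace_box openin_continuous_map_preimage[OF assms(1) U(1)])
      show "Q \<in> {Q \<in> hyperspace_points e S. Q \<subseteq> ?V}"
        using Q(1) U(2) V[of Q] by simp
      show "{Q \<in> hyperspace_points e S. Q \<subseteq> ?V}
          \<subseteq> {Q \<in> hyperspace_points e S. Q_map T f Q \<in> W}"
      proof
        fix Q' assume Q': "Q' \<in> {Q \<in> hyperspace_points e S. Q \<subseteq> ?V}"
        then have "Q_map T f Q' \<in> {Q \<in> hyperspace_points e T. Q \<subseteq> U}"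
          using V[of Q'] Q_map_in_hyperspace[OF assms(1), of Q' e] by simp
        then show "Q' \<in> {Q \<in> hyperspace_points e S. Q_map T f Q \<in> W}"
          using U(3) Q' by auto
      qed
    qed
  qed
qed

section \<open>Projective systems and their canonical limits\<close>

locale proj_system =
  fixes I :: "'i set" and r :: "'i rel"
    and X :: "'i \<Rightarrow> 'a topology" and p :: "'i \<Rightarrow> 'i \<Rightarrow> 'a \<Rightarrow> 'a"
  assumes system: "projective_system I r X p"
begin

abbreviation plim :: "('i \<Rightarrow> 'a) topology" where
  "plim \<equiv> projective_limit I r X p"

lemma index_in: "(i, j) \<in> r \<Longrightarrow> i \<in> I \<and> j \<in> I"
  using system by (auto simp: projective_system_def directed_preorder_on_def preorder_on_def)

lemma index_refl: "i \<in> I \<Longrightarrow> (i, i) \<in> r"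
  using system
  by (auto simp: projective_system_def directed_preorder_on_def preorder_on_def refl_on_def)

lemma index_trans: "(i, j) \<in> r \<Longrightarrow> (j, k) \<in> r \<Longrightarrow> (i, k) \<in> r"
  using system transD[of r i j k]
  by (simp add: projective_system_def directed_preorder_on_def preorder_on_def)

lemma index_directed:
  assumes "i \<in> I" "j \<in> I"
  obtains k where "(i, k) \<in> r" "(j, k) \<in> r"
  using system assms unfolding projective_system_def directed_preorder_on_def by blast

lemma finite_upper_bound:
  assumes "finite J" "J \<subseteq> I"
  shows "\<exists>k\<in>I. \<forall>j\<in>J. (j, k) \<in> r"
  using assms
proof (induction J rule: finite_induct)
  case empty
  then show ?case
    using system by (auto simp: projective_system_def directed_preorder_on_def)
next
  case (insert a J)
  then obtain k where "k \<in> I" "\<forall>j\<in>J. (j, k) \<in> r" by auto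
  moreover obtain l where "(a, l) \<in> r" "(k, l) \<in> r"
    using index_directed[of a k] insert.prems \<open>k \<in> I\<close> by auto
  ultimately show ?case
    using index_in index_trans by blast
qed

lemma transition_continuous: "(i, j) \<in> r \<Longrightarrow> continuous_map (X j) (X i) (p i j)"
  using system by (simp add: projective_system_def)

lemma transition_in: "(i, j) \<in> r \<Longrightarrow> x \<in> topspace (X j) \<Longrightarrow> p i j x \<in> topspace (X i)"
  using transition_continuous continuous_map_image_subset_topspace by blast

lemma transition_ident: "i \<in> I \<Longrightarrow> x \<in> topspace (X i) \<Longrightarrow> p i i x = x"
  using system by (simp add: projective_system_def)

lemma transition_comp:
  "(i, j) \<in> r \<Longrightarrow> (j, k) \<in> r \<Longrightarrow> x \<in> topspace (X k) \<Longrightarrow> p i j (p j k x) = p i k x"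
  using system by (auto simp: projective_system_def)

lemma in_lim_iff:
  "x \<in> topspace plim \<longleftrightarrow>
     x \<in> (\<Pi>\<^sub>E i\<in>I. topspace (X i)) \<and> (\<forall>i j. (i, j) \<in> r \<longrightarrow> p i j (x j) = x i)"
  by (auto simp: projective_limit_def)

lemma coordinate_in: "x \<in> topspace plim \<Longrightarrow> i \<in> I \<Longrightarrow> x i \<in> topspace (X i)"
  by (auto simp: in_lim_iff)

lemma transition_coordinate: "x \<in> topspace plim \<Longrightarrow> (i, j) \<in> r \<Longrightarrow> p i j (x j) = x i"
  by (auto simp: in_lim_iff)

lemma coordinate_continuous: "i \<in> I \<Longrightarrow> continuous_map plim (X i) (\<lambda>x. x i)"
  unfolding projective_limit_def
  by (intro continuous_map_from_subtopology continuous_map_product_projection)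

text \<open>A basic neighbourhood in the product restricts finitely many coordinates; on the limit, all
  these restrictions pull back to a single later coordinate by directedness.\<close>

lemma lim_base:
  assumes "openin plim U" "x \<in> U"
  obtains i V where "i \<in> I" "openin (X i) V" "x i \<in> V" "{y \<in> topspace plim. y i \<in> V} \<subseteq> U"
proof -
  let ?S = "{x. \<forall>i j. (i, j) \<in> r \<longrightarrow> p i j (x j) = x i}"
  obtain W where W: "openin (product_topology X I) W" "U = W \<inter> ?S"
    using assms(1) unfolding projective_limit_def openin_subtopology by auto
  then have "x \<in> W"
    using assms(2) by blast
  then have "\<exists>B. finite {i \<in> I. B i \<noteq> topspace (X i)} \<and> (\<forall>i\<in>I. openin (X i) (B i)) \<and>
      x \<in> Pi\<^sub>E I B \<and> Pi\<^sub>E I B \<subseteq> W"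
    using W(1) by (simp add: openin_product_topology_alt)
  then obtain B where B: "finite {i \<in> I. B i \<noteq> topspace (X i)}" "\<And>i. i \<in> I \<Longrightarrow> openin (X i) (B i)"
    "x \<in> Pi\<^sub>E I B" "Pi\<^sub>E I B \<subseteq> W"
    by auto
  let ?J = "{i \<in> I. B i \<noteq> topspace (X i)}"
  obtain k where k: "k \<in> I" "\<And>j. j \<in> ?J \<Longrightarrow> (j, k) \<in> r"
    using finite_upper_bound[OF B(1)] by blast
  define V where "V = topspace (X k) \<inter> (\<Inter>j\<in>?J. {z \<in> topspace (X k). p j k z \<in> B j})"
  have x: "x \<in> topspace plim"
    using assms openin_subset by blast
  show thesis
  proof
    show "k \<in> I" by (rule k)
    show "openin (X k) V"
      unfolding V_def
    proof (cases "?J = {}")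
      case True
      show "openin (X k) (topspace (X k) \<inter> (\<Inter>j\<in>?J. {z \<in> topspace (X k). p j k z \<in> B j}))"
        by (simp only: True) simp
    next
      case False
      have "openin (X k) (\<Inter>j\<in>?J. {z \<in> topspace (X k). p j k z \<in> B j})"
        using B(1,2) False k
        by (intro openin_INT2 openin_continuous_map_preimage[OF transition_continuous]) auto
      then show "openin (X k) (topspace (X k) \<inter> (\<Inter>j\<in>?J. {z \<in> topspace (X k). p j k z \<in> B j}))"
        by blast
    qed
    show "x k \<in> V"
      using x k B(3) coordinate_in transition_coordinate[OF x] by (auto simp: V_def)
    show "{y \<in> topspace plim. y k \<in> V} \<subseteq> U"
    proof
      fix y assume "y \<in> {y \<in> topspace plim. y k \<in> V}"
      then have y: "y \<in> topspace plim" "y k \<in> V" by auto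
      have "y j \<in> B j" if "j \<in> I" for j
      proof (cases "j \<in> ?J")
        case True
        then have "p j k (y k) \<in> B j"
          using y(2) unfolding V_def by blast
        then show ?thesis
          using transition_coordinate[OF y(1) k(2)[OF True]] by simp
      next
        case False
        then show ?thesis
          using that coordinate_in[OF y(1)] by auto
      qed
      then have "y \<in> Pi\<^sub>E I B"
        using y(1) by (auto simp: in_lim_iff PiE_iff)
      then show "y \<in> U"
        using B(4) W(2) y(1) by (auto simp: in_lim_iff)
    qed
  qed
qed

text \<open>The same reduction for a compact set instead of a point: finitely many basic neighbourhoods
  cover it, and their indices have a common upper bound.\<close>

lemma lim_compact_base:
  assumes "compactin plim Q" "openin plim U" "Q \<subseteq> U"
  obtains i V where "i \<in> I" "openin (X i) V" "Q \<subseteq> {y \<in> topspace plim. y i \<in> V}"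
    "{y \<in> topspace plim. y i \<in> V} \<subseteq> U"
proof -
  define \<B> where "\<B> = {{y \<in> topspace plim. y i \<in> V} | i V.
    i \<in> I \<and> openin (X i) V \<and> {y \<in> topspace plim. y i \<in> V} \<subseteq> U}"
  have "\<forall>B\<in>\<B>. openin plim B"
    using openin_continuous_map_preimage[OF coordinate_continuous] by (auto simp: \<B>_def)
  moreover have "Q \<subseteq> \<Union>\<B>"
  proof
    fix x assume "x \<in> Q"
    then have xU: "x \<in> U" using assms by blast
    obtain i V where "i \<in> I" "openin (X i) V" "x i \<in> V" "{y \<in> topspace plim. y i \<in> V} \<subseteq> U"
      using lim_base[OF assms(2) xU] .
    moreover have "x \<in> topspace plim"
      using xU assms(2) openin_subset by blast
    ultimately show "x \<in> \<Union>\<B>"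
      unfolding \<B>_def by blast
  qed
  ultimately obtain \<F> where \<F>: "finite \<F>" "\<F> \<subseteq> \<B>" "Q \<subseteq> \<Union>\<F>"
    using assms(1) unfolding compactin_def by meson
  have "\<exists>i\<in>I. \<exists>V. openin (X i) V \<and> \<Union>\<F> \<subseteq> {y \<in> topspace plim. y i \<in> V} \<and>
      {y \<in> topspace plim. y i \<in> V} \<subseteq> U"
    using \<F>(1,2)
  proof (induction \<F> rule: finite_induct)
    case empty
    obtain i where "i \<in> I" using finite_upper_bound[of "{}"] by auto
    then show ?case by (intro bexI[of _ i] exI[of _ "{}"]) auto
  next
    case (insert B \<F>)
    from insert.prems have "\<F> \<subseteq> \<B>" "B \<in> \<B>" by auto
    from insert.IH[OF this(1)]
    obtain i V where iV: "i \<in> I" "openin (X i) V" "\<Union>\<F> \<subseteq> {y \<in> topspace plim. y i \<in> V}"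
      "{y \<in> topspace plim. y i \<in> V} \<subseteq> U"
      by (elim bexE exE conjE)
    obtain j V' where jV: "j \<in> I" "openin (X j) V'" "B = {y \<in> topspace plim. y j \<in> V'}"
      "{y \<in> topspace plim. y j \<in> V'} \<subseteq> U"
      using \<open>B \<in> \<B>\<close> unfolding \<B>_def by auto
    obtain k where k: "(i, k) \<in> r" "(j, k) \<in> r"
      using index_directed[OF iV(1) jV(1)] .
    let ?V = "{z \<in> topspace (X k). p i k z \<in> V} \<union> {z \<in> topspace (X k). p j k z \<in> V'}"
    have kI: "k \<in> I" using index_in k by blast
    have eq: "{y \<in> topspace plim. y k \<in> ?V}
        = {y \<in> topspace plim. y i \<in> V} \<union> {y \<in> topspace plim. y j \<in> V'}"
      using k kI coordinate_in by (auto simp: transition_coordinate)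
    show ?case
    proof (intro bexI[OF _ kI] exI[of _ ?V] conjI)
      show "openin (X k) ?V"
        using iV jV k by (intro openin_Un openin_continuous_map_preimage[OF transition_continuous])
      show "\<Union>(insert B \<F>) \<subseteq> {y \<in> topspace plim. y k \<in> ?V}"
        unfolding eq using iV(3) jV(3) by auto
      show "{y \<in> topspace plim. y k \<in> ?V} \<subseteq> U"
        unfolding eq using iV(4) jV(4) by (rule Un_least)
    qed
  qed
  then show thesis
    using that \<F>(3) by (meson subset_trans)
qed

lemma projective_system_hyperspace:
  "projective_system I r (\<lambda>i. hyperspace e (X i)) (\<lambda>i j. Q_map (X i) (p i j))"
  unfolding projective_system_def
proof (intro conjI allI ballI impI)
  show "directed_preorder_on I r"
    using system by (simp add: projective_system_def)
  show "continuous_map (hyperspace e (X j)) (hyperspace e (X i)) (Q_map (X i) (p i j))"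
    if "(i, j) \<in> r" for i j
    using continuous_map_Q_map[OF transition_continuous[OF that]] .
  show "Q_map (X i) (p i i) Q = Q" if "i \<in> I" "Q \<in> topspace (hyperspace e (X i))" for i Q
    using that by (intro Q_map_ident transition_ident)
      (auto simp: topspace_hyperspace compact_saturated_sets_def)
  show "Q_map (X i) (p i j) (Q_map (X j) (p j k) Q) = Q_map (X i) (p i k) Q"
    if "(i, j) \<in> r \<and> (j, k) \<in> r" "Q \<in> topspace (hyperspace e (X k))" for i j k Q
  proof -
    have "Q \<subseteq> topspace (X k)"
      using that(2) by (auto simp: topspace_hyperspace dest: compact_saturated_sets_subset)
    then show ?thesis
      using that(1) transition_in transition_comp
      by (intro Q_map_comp transition_continuous) (auto simp: subset_iff)
  qed
qed

end

section \<open>Limits of closed sets that meet compact saturated sets\<close>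

locale compact_saturated_subsystem = proj_system I r X p
  for I :: "'i set" and r :: "'i rel"
    and X :: "'i \<Rightarrow> 'a topology" and p :: "'i \<Rightarrow> 'i \<Rightarrow> 'a \<Rightarrow> 'a" +
  fixes Q :: "'i \<Rightarrow> 'a set"
  assumes sober: "i \<in> I \<Longrightarrow> sober_space (X i)"
    and compact_saturated: "i \<in> I \<Longrightarrow> Q i \<in> compact_saturated_sets (X i)"
    and transition_Q: "(i, j) \<in> r \<Longrightarrow> x \<in> Q j \<Longrightarrow> p i j x \<in> Q i"
begin

text \<open>The candidate for the compact saturated subset of the limit with images \<open>Q i\<close>.\<close>

definition limit_set :: "('i \<Rightarrow> 'a) set" where
  "limit_set = {x \<in> topspace plim. \<forall>i\<in>I. x i \<in> Q i}"

text \<open>Subfamilies of the projective system consisting of closed sets, none of which misses its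
  \<open>Q i\<close>. Meeting \<open>Q i\<close>, rather than being non-empty, is the condition that survives intersections
  of chains.\<close>

definition meeting_family :: "('i \<Rightarrow> 'a set) \<Rightarrow> bool" where
  "meeting_family C \<longleftrightarrow>
     (\<forall>i\<in>I. closedin (X i) (C i) \<and> C i \<inter> Q i \<noteq> {}) \<and>
     (\<forall>i j. (i, j) \<in> r \<longrightarrow> (\<forall>x\<in>C j. p i j x \<in> C i))"

definition minimal_family :: "('i \<Rightarrow> 'a set) \<Rightarrow> bool" where
  "minimal_family C \<longleftrightarrow>
     meeting_family C \<and> (\<forall>D. meeting_family D \<longrightarrow> D \<le> C \<longrightarrow> D = C)"

lemma meeting_familyI:
  assumes "\<And>i. i \<in> I \<Longrightarrow> closedin (X i) (C i)" "\<And>i. i \<in> I \<Longrightarrow> C i \<inter> Q i \<noteq> {}"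
    and "\<And>i j x. (i, j) \<in> r \<Longrightarrow> x \<in> C j \<Longrightarrow> p i j x \<in> C i"
  shows "meeting_family C"
  using assms by (auto simp: meeting_family_def)

lemma meeting_family_closed: "meeting_family C \<Longrightarrow> i \<in> I \<Longrightarrow> closedin (X i) (C i)"
  by (simp add: meeting_family_def)

lemma meeting_family_transition: "meeting_family C \<Longrightarrow> (i, j) \<in> r \<Longrightarrow> x \<in> C j \<Longrightarrow> p i j x \<in> C i"
  by (simp add: meeting_family_def)

lemma meeting_family_meets:
  assumes "meeting_family C" "i \<in> I"
  obtains x where "x \<in> C i" "x \<in> Q i"
  using assms unfolding meeting_family_def by blast

lemma Q_subset: "i \<in> I \<Longrightarrow> Q i \<subseteq> topspace (X i)"
  using compact_saturated compact_saturated_sets_subset by blast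

text \<open>Compactness of each \<open>Q i\<close> is what keeps the intersection of a chain of families
  meeting \<open>Q i\<close>, so that Zorn's lemma applies.\<close>

lemma minimal_meeting_family:
  assumes "meeting_family C0"
  obtains C where "minimal_family C" "C \<le> C0"
proof -
  define \<A> where "\<A> = {C. meeting_family C \<and> C \<le> C0}"
  have "\<exists>M\<in>\<A>. \<forall>C\<in>\<A>. C \<le> M \<longrightarrow> C = M"
  proof (rule predicate_Zorn[where P = "\<lambda>C D. D \<le> C"])
    show "partial_order_on \<A> (relation_of (\<lambda>C D. D \<le> C) \<A>)"
      by (rule partial_order_on_relation_ofI) auto
    fix \<C> assume "\<C> \<in> Chains (relation_of (\<lambda>C D. D \<le> C) \<A>)"
    then have \<C>: "\<C> \<subseteq> \<A>" "\<And>C D. C \<in> \<C> \<Longrightarrow> D \<in> \<C> \<Longrightarrow> C \<le> D \<or> D \<le> C"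
      unfolding Chains_def relation_of_def by blast+
    show "\<exists>L\<in>\<A>. \<forall>C\<in>\<C>. L \<le> C"
    proof (cases "\<C> = {}")
      case True
      then show ?thesis using assms by (auto simp: \<A>_def)
    next
      case False
      define L where "L i = (\<Inter>C\<in>\<C>. C i)" for i
      have fam: "meeting_family C" if "C \<in> \<C>" for C
        using \<C>(1) that by (auto simp: \<A>_def)
      have "closedin (X i) (L i)" if "i \<in> I" for i
        using fam that False unfolding L_def meeting_family_def by (intro closedin_Inter) auto
      moreover have "L i \<inter> Q i \<noteq> {}" if "i \<in> I" for i
      proof -
        have "Q i \<inter> \<Inter>\<F> \<noteq> {}" if \<F>: "finite \<F>" "\<F> \<subseteq> (\<lambda>C. C i) ` \<C>" for \<F>
        proof (cases "\<F> = {}")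
          case True
          obtain C where "C \<in> \<C>" using False by blast
          then obtain x where "x \<in> Q i"
            using meeting_family_meets[OF fam \<open>i \<in> I\<close>] by metis
          then show ?thesis unfolding True by blast
        next
          case nonempty: False
          have "subset.chain UNIV \<F>"
            unfolding subset_chain_def
          proof (intro conjI ballI)
            fix D D' assume "D \<in> \<F>" "D' \<in> \<F>"
            then obtain C C' where "C \<in> \<C>" "C' \<in> \<C>" "D = C i" "D' = C' i"
              using \<F>(2) by blast
            then show "D \<subseteq> D' \<or> D' \<subseteq> D"
              using \<C>(2)[of C C'] by (auto simp: le_fun_def)
          qed simp
          then have "\<Inter>\<F> \<in> \<F>"
            by (rule Inter_in_chain[OF \<F>(1) nonempty])
          then obtain C where C: "C \<in> \<C>" "\<Inter>\<F> = C i" using \<F>(2) by blast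
          obtain x where "x \<in> C i" "x \<in> Q i"
            by (rule meeting_family_meets[OF fam[OF C(1)] \<open>i \<in> I\<close>])
          then show ?thesis
            unfolding C(2) by blast
        qed
        moreover have "compactin (X i) (Q i)"
          using compact_saturated[OF that] by (simp add: compact_saturated_sets_def)
        moreover have "\<forall>D\<in>(\<lambda>C. C i) ` \<C>. closedin (X i) D"
          using fam that by (auto simp: meeting_family_def)
        ultimately have "Q i \<inter> \<Inter>((\<lambda>C. C i) ` \<C>) \<noteq> {}"
          unfolding compactin_fip by (elim conjE allE[of _ "(\<lambda>C. C i) ` \<C>"] impE) simp_all
        then show ?thesis by (simp add: L_def Int_commute)
      qed
      moreover have "p i j x \<in> L i" if "(i, j) \<in> r" "x \<in> L j" for i j x
        using that meeting_family_transition[OF fam] by (auto simp: L_def)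
      ultimately have "meeting_family L"
        by (rule meeting_familyI)
      moreover have below: "\<forall>C\<in>\<C>. L \<le> C"
        by (auto simp: L_def le_fun_def)
      moreover obtain C where "C \<in> \<C>" using False by blast
      then have "L \<le> C0"
        using below \<C>(1) order_trans by (force simp: \<A>_def)
      ultimately show ?thesis
        by (auto simp: \<A>_def)
    qed
  qed
  then obtain M where M: "M \<in> \<A>" "\<forall>C\<in>\<A>. C \<le> M \<longrightarrow> C = M"
    by blast
  show thesis
  proof
    show "M \<le> C0" using M(1) by (simp add: \<A>_def)
    have "D = M" if "meeting_family D" "D \<le> M" for D
      using M(2) that order_trans[OF that(2) \<open>M \<le> C0\<close>] by (simp add: \<A>_def)
    then show "minimal_family M"
      using M(1) by (simp add: minimal_family_def \<A>_def)
  qed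
qed

text \<open>Cutting a minimal family down to the preimages of a closed \<open>D\<close> at all indices above
  \<open>k\<close> keeps it compatible; by minimality the result must stop meeting some \<open>Q i\<close>.\<close>

lemma minimal_family_cut:
  assumes min: "minimal_family C" and k: "k \<in> I" and D: "closedin (X k) D" "\<not> C k \<subseteq> D"
  obtains i where "(k, i) \<in> r" "\<And>x. x \<in> C i \<Longrightarrow> x \<in> Q i \<Longrightarrow> p k i x \<notin> D"
proof (rule ccontr)
  note found = that
  assume neg: "\<not> thesis"
  have C: "meeting_family C" using min by (simp add: minimal_family_def)
  define B where
    "B i = (if (k, i) \<in> r then {x \<in> C i. p k i x \<in> D} else C i)" for i
  have sub: "C i \<subseteq> topspace (X i)" if "i \<in> I" for i
    using closedin_subset[OF meeting_family_closed[OF C that]] .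
  have "closedin (X i) (B i)" if "i \<in> I" for i
    using closedin_continuous_map_preimage_gen[OF transition_continuous
        meeting_family_closed[OF C that] D(1)] meeting_family_closed[OF C that]
    by (simp add: B_def)
  moreover have "B i \<inter> Q i \<noteq> {}" if "i \<in> I" for i
  proof (cases "(k, i) \<in> r")
    case True
    then obtain x where "x \<in> C i" "x \<in> Q i" "p k i x \<in> D"
      using found[OF True] neg by blast
    then show ?thesis using True by (auto simp: B_def)
  next
    case False
    then show ?thesis using meeting_family_meets[OF C that] by (auto simp: B_def)
  qed
  moreover have "p i j x \<in> B i" if ij: "(i, j) \<in> r" and x: "x \<in> B j" for i j x
  proof -
    have xC: "x \<in> C j" using x by (auto simp: B_def split: if_splits)
    then have "p i j x \<in> C i" by (rule meeting_family_transition[OF C ij])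
    moreover have "p k i (p i j x) \<in> D" if ki: "(k, i) \<in> r"
    proof -
      have "(k, j) \<in> r" using index_trans[OF ki ij] .
      then have "p k j x \<in> D" using x by (simp add: B_def)
      moreover have "x \<in> topspace (X j)" using xC sub index_in[OF ij] by blast
      ultimately show ?thesis using transition_comp[OF ki ij] by simp
    qed
    ultimately show ?thesis by (simp add: B_def)
  qed
  ultimately have "meeting_family B"
    by (rule meeting_familyI)
  moreover have "B \<le> C"
    by (auto simp: B_def le_fun_def)
  ultimately have "B = C" using min by (simp add: minimal_family_def)
  then have "\<forall>x\<in>C k. p k k x \<in> D"
    using index_refl[OF k] by (metis (mono_tags, lifting) B_def mem_Collect_eq)
  then show False
    using D(2) sub[OF k] transition_ident[OF k] by fastforce
qed

text \<open>If \<open>C k\<close> were covered by \<open>D\<close> and \<open>E\<close> without being inside either, cutting by each of them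
  would fail at some index; above both indices, a point of \<open>C l \<inter> Q l\<close> would map into \<open>C k\<close> but
  into neither \<open>D\<close> nor \<open>E\<close>.\<close>

lemma minimal_family_irreducible:
  assumes min: "minimal_family C" and k: "k \<in> I"
  shows "irreducible_closedin (X k) (C k)"
proof -
  have C: "meeting_family C" using min by (simp add: minimal_family_def)
  have "C k \<subseteq> D \<or> C k \<subseteq> E"
    if DE: "closedin (X k) D \<and> closedin (X k) E \<and> C k \<subseteq> D \<union> E" for D E
  proof (rule ccontr)
    assume "\<not> (C k \<subseteq> D \<or> C k \<subseteq> E)"
    then have nD: "\<not> C k \<subseteq> D" and nE: "\<not> C k \<subseteq> E" by auto
    obtain i where i: "(k, i) \<in> r" "\<And>x. x \<in> C i \<Longrightarrow> x \<in> Q i \<Longrightarrow> p k i x \<notin> D"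
      using minimal_family_cut[OF min k _ nD] DE by blast
    obtain j where j: "(k, j) \<in> r" "\<And>x. x \<in> C j \<Longrightarrow> x \<in> Q j \<Longrightarrow> p k j x \<notin> E"
      using minimal_family_cut[OF min k _ nE] DE by blast
    obtain l where l: "(i, l) \<in> r" "(j, l) \<in> r"
      using index_directed[of i j] index_in i(1) j(1) by metis
    have "l \<in> I" using index_in l by blast
    then obtain x where x: "x \<in> C l" "x \<in> Q l"
      by (rule meeting_family_meets[OF C])
    have xt: "x \<in> topspace (X l)" using x Q_subset[OF \<open>l \<in> I\<close>] by blast
    have in_C: "p i l x \<in> C i" "p j l x \<in> C j" "p k l x \<in> C k"
      using x(1) l index_trans[OF i(1) l(1)] by (auto intro: meeting_family_transition[OF C])
    have "p k l x \<notin> D"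
      using i(2)[OF in_C(1) transition_Q[OF l(1) x(2)]] transition_comp[OF i(1) l(1) xt] by simp
    moreover have "p k l x \<notin> E"
      using j(2)[OF in_C(2) transition_Q[OF l(2) x(2)]] transition_comp[OF j(1) l(2) xt] by simp
    ultimately show False
      using DE in_C(3) by blast
  qed
  then show ?thesis
    using meeting_family_closed[OF C k] meeting_family_meets[OF C k]
    unfolding irreducible_closedin_def by blast
qed

text \<open>The generic points of the members of a minimal family are compatible, by uniqueness of
  generic points, and each lies in \<open>Q i\<close> because \<open>Q i\<close> is saturated.\<close>

theorem meeting_family_limit_point:
  assumes "meeting_family C0"
  shows "\<exists>x\<in>limit_set. \<forall>i\<in>I. x i \<in> C0 i"
proof -
  obtain C where min: "minimal_family C" and below: "C \<le> C0"
    using minimal_meeting_family[OF assms] .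
  have C: "meeting_family C" using min by (simp add: minimal_family_def)
  have "\<exists>x\<in>topspace (X i). C i = X i closure_of {x}" if "i \<in> I" for i
    using minimal_family_irreducible[OF min that] sober[OF that]
    by (simp add: sober_space_def)
  then obtain x where x: "\<And>i. i \<in> I \<Longrightarrow> x i \<in> topspace (X i)"
    "\<And>i. i \<in> I \<Longrightarrow> C i = X i closure_of {x i}"
    by metis
  have xC: "x i \<in> C i" if "i \<in> I" for i
    using x[OF that] closure_of_subset[of "{x i}" "X i"] by simp
  have compatible: "p k j (x j) = x k" if kj: "(k, j) \<in> r" for k j
  proof (rule ccontr)
    assume neq: "p k j (x j) \<noteq> x k"
    have k: "k \<in> I" and j: "j \<in> I" using index_in[OF kj] by auto
    let ?y = "p k j (x j)"
    \<comment> \<open>By uniqueness of generic points it suffices that \<open>?y\<close> is generic in \<open>C k\<close>; if it were not,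
        \<open>C\<close> could be cut by the closure of \<open>?y\<close>, which contains the image of all of \<open>C j\<close>.\<close>
    let ?D = "X k closure_of {?y}"
    have y: "?y \<in> topspace (X k)" "?y \<in> C k"
      by (rule transition_in[OF kj x(1)[OF j]], rule meeting_family_transition[OF C kj xC[OF j]])
    have "\<not> C k \<subseteq> ?D"
    proof
      assume "C k \<subseteq> ?D"
      then have "x k \<in> ?D" using xC[OF k] by blast
      then have "specialization (X k) (x k) ?y"
        using specialization_iff_closure_of[OF x(1)[OF k] y(1)] by simp
      moreover have "specialization (X k) ?y (x k)"
        using specialization_iff_closure_of[OF y(1) x(1)[OF k]] x(2)[OF k] y(2) by simp
      ultimately have "\<And>U. openin (X k) U \<Longrightarrow> x k \<in> U \<longleftrightarrow> ?y \<in> U"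
        by (auto simp: specialization_def)
      moreover have "t0_space (X k)" using sober[OF k] by (simp add: sober_space_def)
      ultimately show False
        using neq x(1)[OF k] y(1) unfolding t0_space_def by metis
    qed
    then obtain i where i: "(k, i) \<in> r" "\<And>z. z \<in> C i \<Longrightarrow> z \<in> Q i \<Longrightarrow> p k i z \<notin> ?D"
      using minimal_family_cut[OF min k closedin_closure_of] by blast
    obtain l where l: "(i, l) \<in> r" "(j, l) \<in> r"
      using index_directed[of i j] index_in i(1) j by metis
    have lI: "l \<in> I" using index_in l by blast
    then obtain z where z: "z \<in> C l" "z \<in> Q l"
      by (rule meeting_family_meets[OF C])
    have zt: "z \<in> topspace (X l)" using z Q_subset[OF lI] by blast
    have zC: "p i l z \<in> C i" "p j l z \<in> C j"
      using z(1) l by (auto intro: meeting_family_transition[OF C])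
    have "p k l z \<notin> ?D"
      using i(2)[OF zC(1) transition_Q[OF l(1) z(2)]] transition_comp[OF i(1) l(1) zt] by simp
    moreover have "p k j (p j l z) \<in> ?D"
      using continuous_map_image_closure_subset[OF transition_continuous[OF kj], of "{x j}"]
        zC(2) x(2)[OF j] by auto
    ultimately show False
      using transition_comp[OF kj l(2) zt] by simp
  qed
  have xQ: "x i \<in> Q i" if "i \<in> I" for i
  proof -
    obtain z where z: "z \<in> C i" "z \<in> Q i"
      by (rule meeting_family_meets[OF C \<open>i \<in> I\<close>])
    have "z \<in> topspace (X i)" using z(2) Q_subset[OF that] by blast
    then have "specialization (X i) z (x i)"
      using specialization_iff_closure_of[OF _ x(1)[OF that]] x(2)[OF that] z(1) by simp
    then show ?thesis
      using z compact_saturated[OF that] by (auto simp: compact_saturated_sets_def saturated_in_def)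
  qed
  show ?thesis
  proof (intro bexI[of _ "restrict x I"] ballI)
    have "restrict x I \<in> topspace plim"
      unfolding in_lim_iff using x(1) compatible index_in by auto
    then show "restrict x I \<in> limit_set"
      using xQ by (simp add: limit_set_def)
    show "restrict x I i \<in> C0 i" if "i \<in> I" for i
      using that xC below by (auto simp: le_fun_def)
  qed
qed

text \<open>The complements of the \<open>V i\<close> are compatible closed sets; if no \<open>Q i\<close> were inside \<open>V i\<close>, they
  would meet all \<open>Q i\<close> and hence share a point of \<open>limit_set\<close>.\<close>

lemma limit_set_open_cover:
  assumes V: "\<And>i. i \<in> I \<Longrightarrow> openin (X i) (V i)"
      "\<And>i j x. (i, j) \<in> r \<Longrightarrow> x \<in> topspace (X j) \<Longrightarrow> p i j x \<in> V i \<Longrightarrow> x \<in> V j"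
    and cover: "\<And>x. x \<in> limit_set \<Longrightarrow> \<exists>i\<in>I. x i \<in> V i"
  shows "\<exists>i\<in>I. Q i \<subseteq> V i"
proof (rule ccontr)
  assume neg: "\<not> (\<exists>i\<in>I. Q i \<subseteq> V i)"
  have "(topspace (X i) - V i) \<inter> Q i \<noteq> {}" if "i \<in> I" for i
    using neg that Q_subset[OF that] by blast
  moreover have "p i j x \<in> topspace (X i) - V i"
    if "(i, j) \<in> r" "x \<in> topspace (X j) - V j" for i j x
    using that V(2) transition_in by blast
  moreover have "closedin (X i) (topspace (X i) - V i)" if "i \<in> I" for i
    using V(1)[OF that] by (simp add: closedin_diff)
  ultimately have fam: "meeting_family (\<lambda>i. topspace (X i) - V i)"
    by (intro meeting_familyI)
  obtain x where x: "x \<in> limit_set" "\<forall>i\<in>I. x i \<in> topspace (X i) - V i"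
    using meeting_family_limit_point[OF fam] by (elim bexE)
  from cover[OF x(1)] obtain i where i: "i \<in> I" "x i \<in> V i"
    by (elim bexE)
  show False
    using bspec[OF x(2) i(1)] i(2) by simp
qed

text \<open>Given an open cover of \<open>limit_set\<close>, the open sets of \<open>X i\<close> whose preimage fits inside one member
  of the cover form an increasing system, so for some \<open>i\<close> they cover \<open>Q i\<close>. A finite subcover of
  \<open>Q i\<close> then yields one of \<open>limit_set\<close>.\<close>

lemma limit_set_compact_saturated:
  shows "limit_set \<in> compact_saturated_sets plim"
proof -
  have "compactin plim limit_set"
    unfolding compactin_def
  proof (intro conjI allI impI)
    show "limit_set \<subseteq> topspace plim" by (auto simp: limit_set_def)
    fix \<U> assume \<U>: "(\<forall>U\<in>\<U>. openin plim U) \<and> limit_set \<subseteq> \<Union>\<U>"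
    define \<V> where "\<V> i = {V. openin (X i) V \<and> (\<exists>U\<in>\<U>. {y \<in> topspace plim. y i \<in> V} \<subseteq> U)}" for i
    have "\<exists>i\<in>I. Q i \<subseteq> \<Union>(\<V> i)"
    proof (rule limit_set_open_cover)
      show "openin (X i) (\<Union>(\<V> i))" for i
        by (auto simp: \<V>_def)
      show "x \<in> \<Union>(\<V> j)" if ij: "(i, j) \<in> r" and x: "x \<in> topspace (X j)" "p i j x \<in> \<Union>(\<V> i)" for i j x
      proof -
        obtain V U where VU: "p i j x \<in> V" "openin (X i) V" "U \<in> \<U>" "{y \<in> topspace plim. y i \<in> V} \<subseteq> U"
          using x(2) by (auto simp: \<V>_def)
        let ?W = "{z \<in> topspace (X j). p i j z \<in> V}"
        have "openin (X j) ?W"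
          by (rule openin_continuous_map_preimage[OF transition_continuous[OF ij] VU(2)])
        moreover have "{y \<in> topspace plim. y j \<in> ?W} \<subseteq> U"
          using VU(4) transition_coordinate[OF _ ij] by auto
        ultimately have "?W \<in> \<V> j"
          using VU(3) by (auto simp: \<V>_def)
        then show ?thesis using x(1) VU(1) by blast
      qed
      show "\<exists>i\<in>I. x i \<in> \<Union>(\<V> i)" if x: "x \<in> limit_set" for x
      proof -
        obtain U where U: "U \<in> \<U>" "x \<in> U" using \<U> x by blast
        then have "openin plim U" using \<U> by blast
        obtain i V where V: "i \<in> I" "openin (X i) V" "x i \<in> V" "{y \<in> topspace plim. y i \<in> V} \<subseteq> U"
          using lim_base[OF \<open>openin plim U\<close> U(2)] .
        then have "V \<in> \<V> i" using U(1) by (auto simp: \<V>_def)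
        then show ?thesis using V(1,3) by blast
      qed
    qed
    then obtain i where i: "i \<in> I" "Q i \<subseteq> \<Union>(\<V> i)" by blast
    have "\<forall>V\<in>\<V> i. openin (X i) V" by (auto simp: \<V>_def)
    moreover have "compactin (X i) (Q i)"
      using compact_saturated[OF i(1)] by (simp add: compact_saturated_sets_def)
    ultimately obtain \<F> where \<F>: "finite \<F>" "\<F> \<subseteq> \<V> i" "Q i \<subseteq> \<Union>\<F>"
      using i(2) unfolding compactin_def by meson
    have "\<forall>V\<in>\<F>. \<exists>U. U \<in> \<U> \<and> {y \<in> topspace plim. y i \<in> V} \<subseteq> U"
      using \<F>(2) by (auto simp: \<V>_def)
    from bchoice[OF this] obtain g
      where g: "\<forall>V\<in>\<F>. g V \<in> \<U> \<and> {y \<in> topspace plim. y i \<in> V} \<subseteq> g V"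
      by (elim exE)
    have "limit_set \<subseteq> \<Union>(g ` \<F>)"
    proof
      fix x assume "x \<in> limit_set"
      then have x: "x \<in> topspace plim" "x i \<in> Q i" using i(1) by (auto simp: limit_set_def)
      then obtain V where "V \<in> \<F>" "x i \<in> V" using \<F>(3) by blast
      moreover from this have "x \<in> g V" using bspec[OF g, of V] x(1) by blast
      ultimately show "x \<in> \<Union>(g ` \<F>)" by blast
    qed
    then show "\<exists>\<F>. finite \<F> \<and> \<F> \<subseteq> \<U> \<and> limit_set \<subseteq> \<Union>\<F>"
      using \<F>(1) g by (intro exI[of _ "g ` \<F>"]) auto
  qed
  moreover have "saturated_in plim limit_set"
    unfolding saturated_in_def
  proof (intro conjI ballI allI impI)
    show "limit_set \<subseteq> topspace plim" by (auto simp: limit_set_def)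
    fix x y assume xy: "x \<in> limit_set" "specialization plim x y"
    have "y i \<in> Q i" if "i \<in> I" for i
      using specialization_continuous_map[OF coordinate_continuous[OF that] xy(2)] xy(1)
        compact_saturated[OF that] that
      by (auto simp: limit_set_def compact_saturated_sets_def saturated_in_def)
    then show "y \<in> limit_set"
      using xy(2) by (auto simp: limit_set_def specialization_def)
  qed
  ultimately show ?thesis by (simp add: compact_saturated_sets_def)
qed

text \<open>For \<open>y \<in> Q i\<close>, the closed sets \<open>p i j\<inverse> (closure {y})\<close>, taken at the indices
  \<open>j\<close> above \<open>i\<close>, meet \<open>Q j\<close> because \<open>Q i\<close> is the upward closure of the image of \<open>Q j\<close>. They produce a point of the limit whose \<open>i\<close>-th coordinate is below \<open>y\<close>.\<close>

lemma Q_map_limit_set: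
  assumes exact: "\<And>i j. (i, j) \<in> r \<Longrightarrow> Q_map (X i) (p i j) (Q j) = Q i"
    and i: "i \<in> I"
  shows "Q_map (X i) (\<lambda>x. x i) limit_set = Q i"
proof (intro equalityI subsetI)
  fix y assume "y \<in> Q_map (X i) (\<lambda>x. x i) limit_set"
  then show "y \<in> Q i"
    using compact_saturated[OF i] i
    by (auto simp: Q_map_def up_closure_def limit_set_def compact_saturated_sets_def saturated_in_def)
next
  fix y assume y: "y \<in> Q i"
  have yt: "y \<in> topspace (X i)" using y Q_subset[OF i] by blast
  define C where
    "C j = (if (i, j) \<in> r then {x \<in> topspace (X j). p i j x \<in> X i closure_of {y}}
            else topspace (X j))" for j
  have C_above: "C j \<inter> Q j \<noteq> {}" if ij: "(i, j) \<in> r" for j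
  proof -
    have j: "j \<in> I" using index_in[OF ij] by blast
    obtain x where x: "x \<in> Q j" "specialization (X i) (p i j x) y"
      using y exact[OF ij] by (auto simp: Q_map_def up_closure_def)
    have xt: "x \<in> topspace (X j)" using x(1) Q_subset[OF j] by blast
    then have "x \<in> C j"
      using x(2) ij specialization_iff_closure_of[OF transition_in[OF ij xt] yt] by (simp add: C_def)
    then show ?thesis using x(1) by blast
  qed
  have "C j \<inter> Q j \<noteq> {}" if j: "j \<in> I" for j
  proof -
    obtain k where k: "(i, k) \<in> r" "(j, k) \<in> r" using index_directed[OF i j] .
    obtain x where "x \<in> Q k" using C_above[OF k(1)] by blast
    then have "p j k x \<in> Q j" by (rule transition_Q[OF k(2)])
    then show ?thesis
      using C_above[of j] Q_subset[OF j] by (cases "(i, j) \<in> r") (auto simp: C_def)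
  qed
  moreover have "closedin (X j) (C j)" if "j \<in> I" for j
    using closedin_continuous_map_preimage[OF transition_continuous closedin_closure_of]
    by (auto simp: C_def)
  moreover have "p j k x \<in> C j" if jk: "(j, k) \<in> r" and x: "x \<in> C k" for j k x
  proof -
    have xt: "x \<in> topspace (X k)" using x by (auto simp: C_def split: if_splits)
    have "p i j (p j k x) \<in> X i closure_of {y}" if ij: "(i, j) \<in> r"
      using x index_trans[OF ij jk] transition_comp[OF ij jk xt] by (auto simp: C_def)
    then show ?thesis using transition_in[OF jk xt] by (auto simp: C_def)
  qed
  ultimately have fam: "meeting_family C" by (intro meeting_familyI)
  obtain x where x: "x \<in> limit_set" "\<forall>j\<in>I. x j \<in> C j"
    using meeting_family_limit_point[OF fam] by (elim bexE)
  have xi: "x i \<in> topspace (X i)"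
    using x(1) i coordinate_in by (simp add: limit_set_def)
  have "x i \<in> X i closure_of {y}"
    using bspec[OF x(2) i] index_refl[OF i] transition_ident[OF i xi] by (simp add: C_def)
  then have "specialization (X i) (x i) y"
    using specialization_iff_closure_of[OF xi yt] by simp
  then show "y \<in> Q_map (X i) (\<lambda>x. x i) limit_set"
    using x(1) unfolding Q_map_def up_closure_def by blast
qed

end

section \<open>The hyperspace of the limit\<close>

context proj_system
begin

text \<open>A point outside the saturated set \<open>Q\<close> is above no point of \<open>Q\<close>, so \<open>Q\<close> lies in the complement
  of its closure; by compactness a single coordinate already separates them.\<close>

lemma compact_saturated_determined_by_images:
  assumes Q: "Q \<in> compact_saturated_sets plim" and x: "x \<in> topspace plim"
    and coords: "\<And>i. i \<in> I \<Longrightarrow> x i \<in> Q_map (X i) (\<lambda>x. x i) Q"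
  shows "x \<in> Q"
proof (rule ccontr)
  assume "x \<notin> Q"
  let ?U = "topspace plim - plim closure_of {x}"
  have QU: "Q \<subseteq> ?U"
  proof
    fix q assume q: "q \<in> Q"
    then have qt: "q \<in> topspace plim" using compact_saturated_sets_subset[OF Q] by blast
    have "\<not> specialization plim q x"
      using Q q \<open>x \<notin> Q\<close> by (auto simp: compact_saturated_sets_def saturated_in_def)
    then show "q \<in> ?U"
      using specialization_iff_closure_of[OF qt x] qt by blast
  qed
  have U: "openin plim ?U" by (simp add: openin_diff)
  have "compactin plim Q" using Q by (simp add: compact_saturated_sets_def)
  then obtain i V where iV: "i \<in> I" "openin (X i) V" "Q \<subseteq> {y \<in> topspace plim. y i \<in> V}"
    "{y \<in> topspace plim. y i \<in> V} \<subseteq> ?U"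
    using lim_compact_base[OF _ U QU] by blast
  have "Q_map (X i) (\<lambda>x. x i) Q \<subseteq> V"
    using Q_map_subset_open_iff[OF coordinate_continuous[OF iV(1)]
        compact_saturated_sets_subset[OF Q] iV(2)] iV(3) by blast
  then have "x \<in> ?U" using iV coords[OF iV(1)] x by blast
  moreover have "x \<in> plim closure_of {x}"
    using closure_of_subset[of "{x}" plim] x by simp
  ultimately show False by blast
qed

text \<open>Surjectivity of the comparison map is the existence of \<open>limit_set\<close>. It is also used for
  openness: a compatible family near \<open>\<phi> Q\<close> must come from some \<open>Q'\<close> before one can see that
  \<open>Q'\<close> stays inside the given neighbourhood of \<open>Q\<close>.\<close>

theorem hyperspace_is_projective_limit:
  assumes sober: "\<And>i. i \<in> I \<Longrightarrow> sober_space (X i)"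
  shows "is_projective_limit I r (\<lambda>i. hyperspace e (X i)) (\<lambda>i j. Q_map (X i) (p i j))
    (hyperspace e plim) (\<lambda>i. Q_map (X i) (\<lambda>x. x i))"
proof -
  interpret H: proj_system I r "\<lambda>i. hyperspace e (X i)" "\<lambda>i j. Q_map (X i) (p i j)"
    by (rule proj_system.intro) (rule projective_system_hyperspace)
  define \<phi> where "\<phi> Q = (\<lambda>i\<in>I. Q_map (X i) (\<lambda>x. x i) Q)" for Q
  have coordinate_Q_map: "Q_map (X i) (p i j) (Q_map (X j) (\<lambda>x. x j) Q) = Q_map (X i) (\<lambda>x. x i) Q"
    if ij: "(i, j) \<in> r" and Q: "Q \<in> compact_saturated_sets plim" for i j Q
  proof (rule Q_map_comp[OF transition_continuous[OF ij]])
    have "Q \<subseteq> topspace plim" by (rule compact_saturated_sets_subset[OF Q])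
    then show "(\<lambda>x. x j) ` Q \<subseteq> topspace (X j)" "\<And>x. x \<in> Q \<Longrightarrow> p i j (x j) = x i"
      using coordinate_in transition_coordinate[OF _ ij] index_in[OF ij] by blast+
  qed
  have continuous: "continuous_map (hyperspace e plim) H.plim \<phi>"
    unfolding projective_limit_def[of I r "\<lambda>i. hyperspace e (X i)"]
  proof (rule continuous_map_into_subtopology)
    show "continuous_map (hyperspace e plim) (product_topology (\<lambda>i. hyperspace e (X i)) I) \<phi>"
      unfolding continuous_map_componentwise \<phi>_def
      using continuous_map_Q_map[OF coordinate_continuous] by auto
    show "\<phi> \<in> topspace (hyperspace e plim) \<rightarrow>
        {R. \<forall>i j. (i, j) \<in> r \<longrightarrow> Q_map (X i) (p i j) (R j) = R i}"
      using coordinate_Q_map index_in by (auto simp: \<phi>_def topspace_hyperspace)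
  qed
  have inj: "inj_on \<phi> (topspace (hyperspace e plim))"
  proof -
    have "Q \<subseteq> Q'" if Q: "Q \<in> compact_saturated_sets plim" and Q': "Q' \<in> compact_saturated_sets plim"
      and eq: "\<phi> Q = \<phi> Q'" for Q Q'
    proof
      fix x assume x: "x \<in> Q"
      then have xt: "x \<in> topspace plim" using compact_saturated_sets_subset[OF Q] by blast
      have "x i \<in> Q_map (X i) (\<lambda>x. x i) Q" if "i \<in> I" for i
        using x specialization_refl[OF coordinate_in[OF xt that]]
        by (auto simp: Q_map_def up_closure_def)
      moreover have "Q_map (X i) (\<lambda>x. x i) Q = Q_map (X i) (\<lambda>x. x i) Q'" if "i \<in> I" for i
        using fun_cong[OF eq, of i] that by (simp add: \<phi>_def)
      ultimately show "x \<in> Q'"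
        by (intro compact_saturated_determined_by_images[OF Q' xt]) simp
    qed
    then show ?thesis
      by (intro inj_onI) (simp add: topspace_hyperspace subset_antisym)
  qed
  have surj: "\<exists>Q\<in>topspace (hyperspace e plim). \<phi> Q = R" if R: "R \<in> topspace H.plim" for R
  proof -
    have RE: "R i \<in> hyperspace_points e (X i)" if "i \<in> I" for i
      using H.coordinate_in[OF R that] by (simp add: topspace_hyperspace)
    have exact: "Q_map (X i) (p i j) (R j) = R i" if "(i, j) \<in> r" for i j
      using H.transition_coordinate[OF R that] .
    interpret R: compact_saturated_subsystem I r X p R
    proof
      show "sober_space (X i)" if "i \<in> I" for i
        using sober[OF that] .
      show "R i \<in> compact_saturated_sets (X i)" if "i \<in> I" for i
        using RE[OF that] by blast
      show "p i j x \<in> R i" if ij: "(i, j) \<in> r" and x: "x \<in> R j" for i j x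
      proof -
        have "x \<in> topspace (X j)"
          using x RE compact_saturated_sets_subset index_in[OF ij] by blast
        then have "p i j x \<in> Q_map (X i) (p i j) (R j)"
          using specialization_refl[OF transition_in[OF ij]] x
          by (auto simp: Q_map_def up_closure_def)
        then show ?thesis by (simp add: exact[OF ij])
      qed
    qed
    have image: "Q_map (X i) (\<lambda>x. x i) R.limit_set = R i" if "i \<in> I" for i
      using R.Q_map_limit_set[OF exact that] .
    have "R.limit_set = {} \<longrightarrow> e"
    proof
      assume empty: "R.limit_set = {}"
      obtain i where i: "i \<in> I" using finite_upper_bound[of "{}"] by auto
      then show e
        using image[OF i] RE[OF i] empty by (simp add: Q_map_def up_closure_def)
    qed
    then have "R.limit_set \<in> topspace (hyperspace e plim)"
      using R.limit_set_compact_saturated by (simp add: topspace_hyperspace)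
    moreover have "\<phi> R.limit_set = R"
    proof
      show "\<phi> R.limit_set i = R i" for i
        using image R unfolding H.in_lim_iff by (cases "i \<in> I") (auto simp: \<phi>_def PiE_def extensional_def)
    qed
    ultimately show ?thesis by blast
  qed
  have \<phi>_in: "\<phi> Q \<in> topspace H.plim" if "Q \<in> topspace (hyperspace e plim)" for Q
    using continuous_map_image_subset_topspace[OF continuous] that by blast
  have "open_map (hyperspace e plim) H.plim \<phi>"
    unfolding open_map_def
  proof (intro allI impI)
    fix W assume W: "openin (hyperspace e plim) W"
    show "openin H.plim (\<phi> ` W)"
      unfolding openin_subopen[of _ "\<phi> ` W"]
    proof
      fix R assume "R \<in> \<phi> ` W"
      then obtain Q where Q: "Q \<in> W" "R = \<phi> Q" by blast
      then have QE: "Q \<in> topspace (hyperspace e plim)"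
        using openin_subset[OF W] by blast
      then have Qc: "Q \<in> compact_saturated_sets plim" by (simp add: topspace_hyperspace)
      obtain U where U: "openin plim U" "Q \<subseteq> U"
        "{Q \<in> hyperspace_points e plim. Q \<subseteq> U} \<subseteq> W"
        using hyperspace_box_base[OF W Q(1)] .
      have "compactin plim Q" using Qc by (simp add: compact_saturated_sets_def)
      then obtain i V where iV: "i \<in> I" "openin (X i) V" "Q \<subseteq> {y \<in> topspace plim. y i \<in> V}"
        "{y \<in> topspace plim. y i \<in> V} \<subseteq> U"
        using lim_compact_base[OF _ U(1,2)] by blast
      define N where "N = {R \<in> topspace H.plim. R i \<in> {K \<in> hyperspace_points e (X i). K \<subseteq> V}}"
      have subset_V: "\<phi> Q' i \<subseteq> V \<longleftrightarrow> Q' \<subseteq> {y \<in> topspace plim. y i \<in> V}"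
        if "Q' \<in> topspace (hyperspace e plim)" for Q'
        using that Q_map_subset_open_iff[OF coordinate_continuous[OF iV(1)] _ iV(2), of Q']
          compact_saturated_sets_subset[of Q' plim] iV(1)
        by (simp add: \<phi>_def topspace_hyperspace)
      show "\<exists>N. openin H.plim N \<and> R \<in> N \<and> N \<subseteq> \<phi> ` W"
      proof (intro exI conjI)
        show "openin H.plim N"
          unfolding N_def
          by (rule openin_continuous_map_preimage[OF H.coordinate_continuous[OF iV(1)]
                openin_hyperspace_box[OF iV(2)]])
        show "R \<in> N"
          using \<phi>_in[OF QE] H.coordinate_in[OF \<phi>_in[OF QE] iV(1)] subset_V[OF QE] iV(3) Q(2)
          by (simp add: N_def topspace_hyperspace)
        show "N \<subseteq> \<phi> ` W"
        proof
          fix R' assume R': "R' \<in> N"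
          then obtain Q' where Q': "Q' \<in> topspace (hyperspace e plim)" "\<phi> Q' = R'"
            using surj by (auto simp: N_def)
          then have "Q' \<subseteq> U"
            using subset_V[OF Q'(1)] R' iV(4) by (auto simp: N_def)
          then show "R' \<in> \<phi> ` W"
            using Q' U(3) by (auto simp: topspace_hyperspace)
        qed
      qed
    qed
  qed
  moreover have "\<phi> ` topspace (hyperspace e plim) = topspace H.plim"
    using \<phi>_in surj by blast
  ultimately have "homeomorphic_map (hyperspace e plim) H.plim \<phi>"
    using continuous inj by (intro bijective_open_imp_homeomorphic_map)
  then show ?thesis
    by (simp add: is_projective_limit_def \<phi>_def[abs_def])
qed

end

theorem theorem6p4:
  fixes I :: "'i set" and r :: "'i rel"
    and X :: "'i \<Rightarrow> 'a topology" and p :: "'i \<Rightarrow> 'i \<Rightarrow> 'a \<Rightarrow> 'a"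
  assumes "projective_system I r X p"
    and "\<And>i. i \<in> I \<Longrightarrow> sober_space (X i)"
  shows
    "projective_system I r (\<lambda>i. QV (X i)) (\<lambda>i j. Q_map (X i) (p i j)) \<and>
     is_projective_limit I r (\<lambda>i. QV (X i)) (\<lambda>i j. Q_map (X i) (p i j))
       (QV (projective_limit I r X p)) (\<lambda>i. Q_map (X i) (\<lambda>x. x i)) \<and>
     projective_system I r (\<lambda>i. Q0V (X i)) (\<lambda>i j. Q_map (X i) (p i j)) \<and>
     is_projective_limit I r (\<lambda>i. Q0V (X i)) (\<lambda>i j. Q_map (X i) (p i j))
       (Q0V (projective_limit I r X p)) (\<lambda>i. Q_map (X i) (\<lambda>x. x i))"
proof -
  interpret proj_system I r X p
    by (rule proj_system.intro) (rule assms(1))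
  show ?thesis
    unfolding QV_eq_hyperspace Q0V_eq_hyperspace
    using projective_system_hyperspace hyperspace_is_projective_limit assms(2) by simp
qed

end
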